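(* Let $\ell$ be an odd positive integer, $k$ a positive integer, and $m=2^k\ell$. Let $N$ be the smallest nonnegative integer such that the sequence $\{t_n\bmod m\}_{n\ge N}$ is periodic (i.e. there is $d\ge1$ with $t_{n+d}\equiv t_n\pmod m$ for all $n\ge N$). Then $N=4k-2$, and $\ell$ is the smallest period of $\{t_n\bmod m\}_{n\ge N}$.
   Context: $t_n$ is the number of involutions of $[n]$ (permutations $\pi$ with $\pi^2=1$), with $t_0=1$. *)

theory Defs
  imports Main "HOL-Combinatorics.Permutations" "HOL-Number_Theory.Cong"
begin

text \<open>Permutations of \<open>{1..n}\<close> are total functions that are the identity outside \<open>{1..n}\<close>.\<close>

definition involutions :: "nat \<Rightarrow> (nat \<Rightarrow> nat) set" where
  "involutions n = {p. p permutes {1..n} \<and> p \<circ> p = id}"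

definition num_involutions :: "nat \<Rightarrow> nat" where
  "num_involutions n = card (involutions n)"

definition is_period_mod_from :: "(nat \<Rightarrow> nat) \<Rightarrow> nat \<Rightarrow> nat \<Rightarrow> nat \<Rightarrow> bool" where
  "is_period_mod_from a m N d \<longleftrightarrow> d \<ge> 1 \<and> (\<forall>n\<ge>N. [a (n + d) = a n] (mod m))"

definition periodic_mod_from :: "(nat \<Rightarrow> nat) \<Rightarrow> nat \<Rightarrow> nat \<Rightarrow> bool" where
  "periodic_mod_from a m N \<longleftrightarrow> (\<exists>d. is_period_mod_from a m N d)"

lemma num_involutions_0: "num_involutions 0 = 1"
proof -
  have "involutions 0 = {id}"
    by (auto simp: involutions_def)
  then show ?thesis
    by (simp add: num_involutions_def)
qed

end

(* From the recurrence t (n + 2) = t (n + 1) + (n + 1) t n one reads off by induction on q that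
   t (4 q) = 2^q a and t (4 q + 1) = 2^q b with a, b odd and congruent modulo 4. Hence 2^k divides
   t n for all n \<ge> 4 k - 2, but not t (4 k - 3), which fixes the start of the periodicity.
   In t l = sum over j of (l choose 2 j) (2 j - 1)!! every term with j > 0 becomes a multiple of l
   after multiplication by 2^j, so t l = 1 modulo an odd l; by the recurrence l is a period modulo l.
   Conversely a period d modulo l has t d = t (d + 1) = 1 and t (d + 2) = 2, and the recurrence
   then forces l to divide d. *)
theory Submission imports Defs begin

fun involution_number :: "nat \<Rightarrow> nat" where
  "involution_number 0 = 1"
| "involution_number (Suc 0) = 1"
| "involution_number (Suc (Suc n)) = involution_number (Suc n) + Suc n * involution_number n"

text \<open>Taking the index equations as premises lets the recurrence be applied at indices such as
  \<open>4 * q + 2\<close>, which are not written with \<open>Suc\<close>.\<close>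

lemma involution_number_rec:
  "i = Suc n \<Longrightarrow> j = Suc i \<Longrightarrow>
    involution_number j = involution_number i + i * involution_number n"
  by simp

section \<open>Counting involutions\<close>

text \<open>Arbitrary ground sets are allowed because deleting a 2-cycle from \<open>{1..n}\<close>
  need not leave an initial segment.\<close>

definition involutions_on :: "'a set \<Rightarrow> ('a \<Rightarrow> 'a) set" where
  "involutions_on S = {p. p permutes S \<and> p \<circ> p = id}"

lemma finite_involutions_on: "finite S \<Longrightarrow> finite (involutions_on S)"
  by (rule finite_subset[OF _ finite_permutations[of S]]) (auto simp: involutions_on_def)

lemma involutions_on_insert_fixing:
  assumes "x \<notin> S"
  shows "{p \<in> involutions_on (insert x S). p x = x} = involutions_on S"
proof -
  have "p permutes S" if "p permutes insert x S" "p x = x" for p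
    using permutes_superset[OF that(1), of S] that(2) by auto
  moreover have "p permutes insert x S" "p x = x" if "p permutes S" for p
    using that assms by (auto intro: permutes_subset permutes_not_in)
  ultimately show ?thesis
    by (auto simp: involutions_on_def)
qed

text \<open>Composing with \<open>transpose x i\<close> attaches or removes the 2-cycle on
  \<open>x\<close> and \<open>i\<close>, so the same map serves as its own inverse. Away from these
  two points an involution preserving the pair never lands on them, and the transposition does not
  act.\<close>

lemma bij_betw_involutions_on_swapping:
  assumes "x \<notin> S" "i \<in> S"
  shows "bij_betw (\<lambda>q. q \<circ> transpose x i) (involutions_on (S - {i}))
           {p \<in> involutions_on (insert x S). p x = i}"
proof (rule bij_betwI[where g = "\<lambda>p. p \<circ> transpose x i"])
  show "(\<lambda>q. q \<circ> transpose x i) \<in> involutions_on (S - {i}) \<rightarrow>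
          {p \<in> involutions_on (insert x S). p x = i}"
  proof
    fix q assume "q \<in> involutions_on (S - {i})"
    then have q: "q permutes S - {i}" and qq: "\<And>z. q (q z) = z"
      by (auto simp: involutions_on_def fun_eq_iff)
    have fix_xi: "q x = x" "q i = i"
      using q assms by (auto intro: permutes_not_in)
    have "q permutes insert x S"
      using q by (rule permutes_subset) auto
    then have "q \<circ> transpose x i permutes insert x S"
      using assms by (intro permutes_compose permutes_swap_id) auto
    moreover have "(q \<circ> transpose x i) ((q \<circ> transpose x i) z) = z" for z
    proof (cases "z = x \<or> z = i")
      case False
      then have "q z \<noteq> x" "q z \<noteq> i"
        using qq fix_xi by metis+
      then show ?thesis
        using False qq by simp
    qed (auto simp: fix_xi)
    ultimately show "q \<circ> transpose x i \<in> {p \<in> involutions_on (insert x S). p x = i}"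
      by (auto simp: involutions_on_def fun_eq_iff fix_xi)
  qed
  show "(\<lambda>p. p \<circ> transpose x i) \<in> {p \<in> involutions_on (insert x S). p x = i} \<rightarrow>
          involutions_on (S - {i})"
  proof
    fix p assume "p \<in> {p \<in> involutions_on (insert x S). p x = i}"
    then have p: "p permutes insert x S" and pp: "\<And>z. p (p z) = z" and px: "p x = i"
      by (auto simp: involutions_on_def fun_eq_iff)
    have pi: "p i = x"
      using pp[of x] px by simp
    have "p \<circ> transpose x i permutes insert x S"
      using p assms by (intro permutes_compose permutes_swap_id) auto
    then have "p \<circ> transpose x i permutes S - {i}"
      by (rule permutes_superset) (auto simp: px pi)
    moreover have "(p \<circ> transpose x i) ((p \<circ> transpose x i) z) = z" for z
    proof (cases "z = x \<or> z = i")
      case False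
      then have "p z \<noteq> x" "p z \<noteq> i"
        using pp px pi by metis+
      then show ?thesis
        using False pp by simp
    qed (auto simp: px pi)
    ultimately show "p \<circ> transpose x i \<in> involutions_on (S - {i})"
      by (auto simp: involutions_on_def fun_eq_iff)
  qed
qed (auto simp: fun_eq_iff)

text \<open>Involutions are sorted by the image of \<open>x\<close>: either \<open>x\<close> is
  fixed, or it is swapped with some \<open>i\<close> in \<open>S\<close>.\<close>

lemma card_involutions_on_insert:
  assumes "finite S" "x \<notin> S"
  shows "card (involutions_on (insert x S)) =
    card (involutions_on S) + (\<Sum>i\<in>S. card (involutions_on (S - {i})))"
proof -
  let ?I = "\<lambda>i. {p \<in> involutions_on (insert x S). p x = i}"
  have "p x \<in> insert x S" if "p \<in> involutions_on (insert x S)" for p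
    using that permutes_in_image[of p "insert x S" x] by (simp add: involutions_on_def)
  then have "involutions_on (insert x S) = (\<Union>i\<in>insert x S. ?I i)"
    by auto
  also have "card \<dots> = (\<Sum>i\<in>insert x S. card (?I i))"
    using assms finite_involutions_on[of "insert x S"] by (intro card_UN_disjoint) auto
  also have "\<dots> = card (?I x) + (\<Sum>i\<in>S. card (?I i))"
    using assms by simp
  also have "card (?I x) = card (involutions_on S)"
    using assms by (simp add: involutions_on_insert_fixing)
  also have "(\<Sum>i\<in>S. card (?I i)) = (\<Sum>i\<in>S. card (involutions_on (S - {i})))"
    using bij_betw_same_card[OF bij_betw_involutions_on_swapping[OF assms(2)]]
    by (intro sum.cong) auto
  finally show ?thesis .
qed

lemma card_involutions_on:
  assumes "finite S"
  shows "card (involutions_on S) = involution_number (card S)"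
  using assms
proof (induction "card S" arbitrary: S rule: less_induct)
  case less
  show ?case
  proof (cases "S = {}")
    case True
    have "involutions_on S = {id}"
      by (auto simp: True involutions_on_def)
    then show ?thesis
      by (simp add: True)
  next
    case False
    then obtain x R where S: "S = insert x R" "x \<notin> R"
      by (metis ex_in_conv mk_disjoint_insert)
    then have R: "finite R" "card S = Suc (card R)"
      using less.prems by auto
    \<comment> \<open>For empty \<open>R\<close> the subtraction truncates, but then both sums are
      empty.\<close>
    have "(\<Sum>i\<in>R. card (involutions_on (R - {i}))) =
        (\<Sum>i\<in>R. involution_number (card R - 1))"
      using R less.hyps by (intro sum.cong) auto
    then have "card (involutions_on S) =
        involution_number (card R) + card R * involution_number (card R - 1)"
      using card_involutions_on_insert[OF R(1) S(2)] less.hyps R S by simp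
    then show ?thesis
      using R(2) by (cases "card R") auto
  qed
qed

lemma num_involutions_eq: "num_involutions = involution_number"
proof
  show "num_involutions n = involution_number n" for n
    using card_involutions_on[of "{1..n}"]
    by (simp add: num_involutions_def involutions_def involutions_on_def)
qed

section \<open>Periodicity modulo an odd number\<close>

text \<open>This is (2j - 1)!!, the number of perfect matchings of 2j points.\<close>

fun odd_double_fact :: "nat \<Rightarrow> nat" where
  "odd_double_fact 0 = 1"
| "odd_double_fact (Suc j) = (2 * j + 1) * odd_double_fact j"

lemma odd_double_fact: "2 ^ j * fact j * odd_double_fact j = fact (2 * j)"
proof (induction j)
  case (Suc j)
  have "2 ^ Suc j * fact (Suc j) * odd_double_fact (Suc j) =
      2 * Suc j * (2 * j + 1) * (2 ^ j * fact j * odd_double_fact j)"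
    by (simp only: power_Suc fact_Suc odd_double_fact.simps of_nat_id mult_ac)
  also have "\<dots> = fact (2 * Suc j)"
    unfolding Suc.IH by (simp add: algebra_simps)
  finally show ?case .
qed simp

text \<open>Term \<open>j\<close> counts the involutions with exactly \<open>j\<close> 2-cycles.
  Terms with 2j > n vanish, so any bound \<open>M\<close> above \<open>n\<close> works; this freedom
  lets the induction use different bounds for its two predecessors.\<close>

lemma involution_number_eq_sum:
  "n < M \<Longrightarrow> involution_number n = (\<Sum>j<M. (n choose (2 * j)) * odd_double_fact j)"
proof (induction n arbitrary: M rule: involution_number.induct)
  case 1
  then obtain M' where M: "M = Suc M'" by (cases M) auto
  show ?case unfolding M sum.lessThan_Suc_shift by simp
next
  case 2
  then obtain M' where M: "M = Suc M'" by (cases M) auto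
  show ?case unfolding M sum.lessThan_Suc_shift by simp
next
  case (3 n)
  then obtain M' where M: "M = Suc M'" by (cases M) auto
  \<comment> \<open>Pascal's rule splits the binomial; in the second part the factor 2j + 1 of the
    double factorial is absorbed, producing \<open>Suc n\<close>.\<close>
  have "(Suc (Suc n) choose (2 * Suc j)) * odd_double_fact (Suc j) =
      (Suc n choose (2 * Suc j)) * odd_double_fact (Suc j) +
      Suc n * ((n choose (2 * j)) * odd_double_fact j)" for j
  proof -
    have "(Suc n choose Suc (2 * j)) * Suc (2 * j) = Suc n * (n choose (2 * j))"
      using Suc_times_binomial_eq[of n "2 * j"] by simp
    then have "(Suc n choose Suc (2 * j)) * odd_double_fact (Suc j) =
        Suc n * ((n choose (2 * j)) * odd_double_fact j)"
      by (metis Suc_eq_plus1 mult.assoc odd_double_fact.simps(2))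
    moreover have "Suc (Suc n) choose (2 * Suc j) =
        (Suc n choose Suc (2 * j)) + (Suc n choose (2 * Suc j))"
      by (simp only: mult_Suc_right add_2_eq_Suc binomial_Suc_Suc)
    ultimately show ?thesis
      by (simp only: add_mult_distrib add.commute)
  qed
  then have "(\<Sum>j<M. (Suc (Suc n) choose (2 * j)) * odd_double_fact j) =
      (\<Sum>j<M. (Suc n choose (2 * j)) * odd_double_fact j) +
      Suc n * (\<Sum>j<M'. (n choose (2 * j)) * odd_double_fact j)"
    unfolding M sum.lessThan_Suc_shift sum_distrib_left
    by (simp only: sum.distrib) simp
  also have "\<dots> = involution_number (Suc (Suc n))"
    using "3.IH"(1)[of M] "3.IH"(2)[of M'] "3.prems" M by simp
  finally show ?case by simp
qed

text \<open>Multiplied by 2^j, the term becomes j! (l choose j) (l - j choose j). Here j! (l choose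
  j) is the falling factorial l (l - 1) ... (l - j + 1), a multiple of \<open>l\<close> for j > 0,
  and 2^j cancels because \<open>l\<close> is odd.\<close>

lemma odd_dvd_binomial_odd_double_fact:
  assumes "odd l" "j > 0"
  shows "l dvd (l choose (2 * j)) * odd_double_fact j"
proof (cases "2 * j \<le> l")
  case True
  have "fact j * (2 ^ j * ((l choose (2 * j)) * odd_double_fact j)) =
      fact (2 * j) * (l choose (2 * j))"
    unfolding odd_double_fact[symmetric] by (simp add: mult_ac)
  also have "fact (2 * j) = (fact j * fact j * ((2 * j) choose j) :: nat)"
    using binomial_fact_lemma[of j "2 * j"] by simp
  \<comment> \<open>Choosing 2j elements and then j of them amounts to choosing j elements and then
    j of the remaining l - j.\<close>
  also have "fact j * fact j * ((2 * j) choose j) * (l choose (2 * j)) =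
      fact j * (fact j * ((l choose j) * ((l - j) choose j)))"
    using choose_mult[of j "2 * j" l] True by (simp add: mult_ac)
  finally have *: "2 ^ j * ((l choose (2 * j)) * odd_double_fact j) =
      fact j * (l choose j) * ((l - j) choose j)"
    by simp
  obtain i where i: "j = Suc i"
    using assms(2) by (cases j) auto
  obtain r where r: "l = Suc r"
    using assms(1) by (cases l) auto
  have "Suc i * (l choose j) = l * (r choose i)"
    using Suc_times_binomial_eq[of r i] unfolding i r by (simp only: mult.commute)
  moreover have "fact j * (l choose j) = fact i * (Suc i * (l choose j))"
    by (simp add: i algebra_simps del: binomial_Suc_Suc)
  ultimately have "l dvd 2 ^ j * ((l choose (2 * j)) * odd_double_fact j)"
    unfolding * by simp
  then show ?thesis
    using assms(1) by (simp add: coprime_dvd_mult_right_iff)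
qed (simp add: binomial_eq_0)

lemma involution_number_cong_1:
  assumes "odd l"
  shows "[involution_number l = 1] (mod l)"
proof -
  have "involution_number l =
      1 + (\<Sum>j<l. (l choose (2 * Suc j)) * odd_double_fact (Suc j))"
    using involution_number_eq_sum[of l "Suc l"] by (simp only: sum.lessThan_Suc_shift) simp
  moreover have "l dvd (\<Sum>j<l. (l choose (2 * Suc j)) * odd_double_fact (Suc j))"
    using assms by (intro dvd_sum odd_dvd_binomial_odd_double_fact) auto
  ultimately show ?thesis
    by (simp only: cong_add_lcancel_0_nat cong_0_iff)
qed

text \<open>The coefficient in the recurrence is itself \<open>l\<close>-periodic modulo
  \<open>l\<close>, so agreement at the indices 0 and 1 propagates to all \<open>n\<close>.\<close>

lemma involution_number_period:
  assumes "odd l"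
  shows "[involution_number (n + l) = involution_number n] (mod l)"
proof (induction n rule: involution_number.induct)
  case 1
  then show ?case using involution_number_cong_1[OF assms] by simp
next
  case 2
  obtain r where r: "l = Suc r"
    using assms by (cases l) auto
  have "involution_number (Suc l) = involution_number l + l * involution_number r"
    by (simp add: r)
  then show ?case
    using involution_number_cong_1[OF assms] by (simp add: cong_def)
next
  case (3 n)
  have "[Suc (n + l) = Suc n] (mod l)"
    by (simp add: cong_def flip: add_Suc)
  then have "[involution_number (Suc (n + l)) + Suc (n + l) * involution_number (n + l) =
      involution_number (Suc n) + Suc n * involution_number n] (mod l)"
    using 3 by (intro cong_add cong_mult) simp_all
  then show ?case
    by (simp only: add_Suc involution_number.simps)
qed

lemma involution_number_period_mult:
  assumes "odd l"
  shows "[involution_number (n + c * l) = involution_number n] (mod l)"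
proof (induction c)
  case (Suc c)
  have "[involution_number ((n + c * l) + l) = involution_number n] (mod l)"
    using involution_number_period[OF assms] Suc.IH by (rule cong_trans)
  then show ?case by (simp add: ac_simps)
qed simp

lemma dvd_period:
  assumes "odd l" and period: "\<And>n. n \<ge> N \<Longrightarrow>
    [involution_number (n + d) = involution_number n] (mod l)"
  shows "l dvd d"
proof -
  \<comment> \<open>Since \<open>l\<close> is a period from 0 on, a shift by \<open>N * l\<close>
    moves any index past \<open>N\<close>, where \<open>d\<close> is known to be a period.\<close>
  have from_0: "[involution_number (n + d) = involution_number n] (mod l)" for n
  proof -
    have "l > 0" using assms(1) by (cases l) auto
    then have "n + N * l \<ge> N" by (simp add: trans_le_add2)
    from period[OF this]
    have "[involution_number (n + d + N * l) = involution_number (n + N * l)] (mod l)"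
      by (simp add: ac_simps)
    then show ?thesis
      using involution_number_period_mult[OF assms(1), of n N]
        involution_number_period_mult[OF assms(1), of "n + d" N] by (simp add: cong_def)
  qed
  let ?t = involution_number
  have t: "[?t d = 1] (mod l)" "[?t (Suc d) = 1] (mod l)" "[?t (Suc (Suc d)) = 2] (mod l)"
    using from_0[of 0] from_0[of "Suc 0"] from_0[of "Suc (Suc 0)"] by (simp_all add: numeral_2_eq_2)
  \<comment> \<open>The left side is \<open>?t (Suc (Suc d))\<close>, so d + 2 and 2 agree modulo
    \<open>l\<close>.\<close>
  have "[?t (Suc d) + Suc d * ?t d = 1 + Suc d * 1] (mod l)"
    using t by (intro cong_add cong_mult) auto
  then have "[2 + d = 2 + 0] (mod l)"
    using t(3) by (simp add: cong_def)
  then show ?thesis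
    by (simp only: cong_add_lcancel_nat) (simp add: cong_0_iff)
qed

section \<open>Divisibility by powers of two\<close>

text \<open>Four steps of the recurrence carry the pair from \<open>q\<close> to
  \<open>Suc q\<close>. Writing the second odd part as \<open>a + 4 * c\<close> records the
  congruence modulo 4 without subtraction.\<close>

lemma involution_number_mult_4:
  "\<exists>a c. odd a \<and> involution_number (4 * q) = 2 ^ q * a \<and>
    involution_number (4 * q + 1) = 2 ^ q * (a + 4 * c)"
proof (induction q)
  case (Suc q)
  let ?t = involution_number
  from Suc obtain a c where ac: "odd a" "?t (4 * q) = 2 ^ q * a"
    "?t (4 * q + 1) = 2 ^ q * (a + 4 * c)" by blast
  have rec: "?t (4 * q + 2) = ?t (4 * q + 1) + (4 * q + 1) * ?t (4 * q)"
    "?t (4 * q + 3) = ?t (4 * q + 2) + (4 * q + 2) * ?t (4 * q + 1)"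
    "?t (4 * Suc q) = ?t (4 * q + 3) + (4 * q + 3) * ?t (4 * q + 2)"
    "?t (4 * Suc q + 1) = ?t (4 * Suc q) + (4 * Suc q) * ?t (4 * q + 3)"
    by (rule involution_number_rec; simp)+
  \<comment> \<open>With b = a + 4c the recurrence gives t (4q + 4) = 2^q (2 (4q + 3) b + (4q + 1)
    (4q + 4) a); \<open>a'\<close> is half of the bracket.\<close>
  define a' where "a' = (4 * q + 3) * (a + 4 * c) + (4 * q + 1) * (2 * q + 2) * a"
  \<comment> \<open>The difference t (4q + 5) - t (4q + 4) is (4q + 4) t (4q + 3), where t (4q + 3)
    = 2^q ((4q + 3) b + (4q + 1) a) and the bracket is a multiple of 4.\<close>
  define c' where "c' = (q + 1) * ((4 * q + 2) * a + 2 * (4 * q + 3) * c)"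
  have "odd a'"
    using ac(1) by (simp add: a'_def)
  moreover have "involution_number (4 * Suc q) = 2 ^ Suc q * a'"
    unfolding rec ac a'_def by (simp add: algebra_simps)
  moreover have "involution_number (4 * Suc q + 1) = 2 ^ Suc q * (a' + 4 * c')"
    unfolding rec ac a'_def c'_def by (simp add: algebra_simps)
  ultimately show ?case by blast
qed (auto intro!: exI[of _ 1] exI[of _ 0])

lemma not_dvd_involution_number: "\<not> 2 ^ Suc q dvd involution_number (4 * q + 1)"
proof -
  obtain a c where "odd a" "involution_number (4 * q + 1) = 2 ^ q * (a + 4 * c)"
    using involution_number_mult_4 by blast
  moreover have "2 ^ Suc q = 2 ^ q * (2 :: nat)" by simp
  ultimately show ?thesis
    by (simp only: dvd_mult_cancel_left) simp
qed

text \<open>Two consecutive multiples make all later values multiples. The extra factor 2 comes at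
  4q + 2 from adding two odd multiples of 2^q, and at 4q + 3 from the even coefficient 4q +
  2.\<close>

lemma dvd_involution_number: "2 ^ Suc q dvd involution_number (4 * q + 2 + n)"
proof (induction n rule: involution_number.induct)
  obtain a c where ac: "involution_number (4 * q) = 2 ^ q * a"
    "involution_number (4 * q + 1) = 2 ^ q * (a + 4 * c)"
    using involution_number_mult_4[of q] by blast
  have rec: "involution_number (4 * q + 2) =
      involution_number (4 * q + 1) + (4 * q + 1) * involution_number (4 * q)"
    "involution_number (4 * q + 2 + Suc 0) =
      involution_number (4 * q + 2) + (4 * q + 2) * involution_number (4 * q + 1)"
    by (rule involution_number_rec; simp)+
  have "involution_number (4 * q + 2) = 2 ^ Suc q * (a + 2 * c + 2 * q * a)"
    unfolding rec ac by (simp add: algebra_simps)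
  then have case_0: "2 ^ Suc q dvd involution_number (4 * q + 2)"
    by simp
  then show "2 ^ Suc q dvd involution_number (4 * q + 2 + 0)"
    by simp
  have "(4 * q + 2) * involution_number (4 * q + 1) = 2 ^ Suc q * ((2 * q + 1) * (a + 4 * c))"
    unfolding ac by (simp add: algebra_simps)
  then show "2 ^ Suc q dvd involution_number (4 * q + 2 + Suc 0)"
    unfolding rec(2) using case_0 by (simp only: dvd_add dvd_triv_left)
next
  case (3 n)
  then show ?case by (simp del: power_Suc)
qed

theorem theorem6p3:
  fixes l k m N :: nat
  assumes "odd l" and "k \<ge> 1" and "m = 2 ^ k * l"
    and "N = (LEAST N. periodic_mod_from num_involutions m N)"
  shows "(\<exists>N. periodic_mod_from num_involutions m N)
    \<and> N = 4 * k - 2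
    \<and> l = (LEAST d. is_period_mod_from num_involutions m N d)"
proof -
  let ?t = involution_number
  obtain q where q: "k = Suc q"
    using assms(2) by (cases k) auto
  have "l > 0"
    using assms(1) by (cases l) auto
  have zero: "2 ^ k dvd ?t n" if "n \<ge> 4 * k - 2" for n
  proof -
    have "4 * q + 2 + (n - (4 * q + 2)) = n"
      using that q by simp
    then show ?thesis
      using dvd_involution_number q by metis
  qed
  \<comment> \<open>Modulo 2^k the tail is zero, so any shift works there; the coprime moduli 2^k
    and \<open>l\<close> are then combined.\<close>
  have period: "is_period_mod_from ?t m (4 * k - 2) l"
    unfolding is_period_mod_from_def
  proof (intro conjI allI impI)
    fix n assume n: "4 * k - 2 \<le> n"
    have "[?t (n + l) = ?t n] (mod 2 ^ k)"
      using zero[of n] zero[of "n + l"] n by (simp add: cong_def dvd_eq_mod_eq_0)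
    then show "[?t (n + l) = ?t n] (mod m)"
      unfolding assms(3)
      using involution_number_period[OF assms(1)] assms(1)
      by (intro coprime_cong_mult_nat) auto
  qed (use \<open>l > 0\<close> in simp)
  \<comment> \<open>An earlier start would include the index 4k - 3 = 4q + 1; adding a period leads
    into the zero tail, so 2^k would divide t (4k - 3).\<close>
  have lower: "4 * k - 2 \<le> N'" if "periodic_mod_from ?t m N'" for N'
  proof (rule ccontr)
    assume "\<not> 4 * k - 2 \<le> N'"
    then have N': "N' \<le> 4 * q + 1" using q by simp
    obtain d where d: "d \<ge> 1" "\<And>n. n \<ge> N' \<Longrightarrow> [?t (n + d) = ?t n] (mod m)"
      using \<open>periodic_mod_from ?t m N'\<close> by (auto simp: periodic_mod_from_def is_period_mod_from_def)
    have "[?t (4 * q + 1 + d) = ?t (4 * q + 1)] (mod 2 ^ k)"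
      by (rule cong_dvd_modulus_nat[OF d(2)[OF N']]) (simp add: assms(3))
    moreover have "2 ^ k dvd ?t (4 * q + 1 + d)"
      using d(1) q by (intro zero) simp
    ultimately have "2 ^ Suc q dvd ?t (4 * q + 1)"
      unfolding q by (metis cong_dvd_iff)
    then show False
      using not_dvd_involution_number by blast
  qed
  have periodic: "periodic_mod_from ?t m (4 * k - 2)"
    using period by (auto simp: periodic_mod_from_def)
  then have N: "N = 4 * k - 2"
    unfolding assms(4) num_involutions_eq using lower by (intro Least_equality) auto
  \<comment> \<open>A period modulo \<open>m\<close> is one modulo its divisor \<open>l\<close>,
    hence a positive multiple of \<open>l\<close>.\<close>
  have "l \<le> d" if "is_period_mod_from ?t m (4 * k - 2) d" for d
  proof -
    have d: "d \<ge> 1" "\<And>n. n \<ge> 4 * k - 2 \<Longrightarrow> [?t (n + d) = ?t n] (mod m)"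
      using that by (auto simp: is_period_mod_from_def)
    have "[?t (n + d) = ?t n] (mod l)" if "n \<ge> 4 * k - 2" for n
      by (rule cong_dvd_modulus_nat[OF d(2)[OF that]]) (simp add: assms(3))
    then have "l dvd d"
      using dvd_period[OF assms(1)] by blast
    then show ?thesis
      using d(1) by (simp add: dvd_imp_le)
  qed
  then have "(LEAST d. is_period_mod_from ?t m (4 * k - 2) d) = l"
    using period by (intro Least_equality) auto
  then show ?thesis
    unfolding num_involutions_eq using periodic N by auto
qed

end
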